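(* Let $n\ge0$. The distribution of peak sets in the symmetric group $S_{n+1}$ gives a nonnegative eigenvector of $\vartheta$ in $\Pi_{n+1}$ for the eigenvalue $2^{n+1}$. That is, if $$p_{n+1}=\sum_{S\subset[n]\ \text{left sparse}}p_S\,\Theta_S,$$ where $p_S$ is the number of permutations in $S_{n+1}$ with peak set $S$, then $$\vartheta(p_{n+1})=2^{n+1}p_{n+1}.$$
   Context: For a composition $\beta=(\beta_1,\dots,\beta_k)$, $M_\beta=\sum_{i_1<\cdots<i_k}x_{i_1}^{\beta_1}\cdots x_{i_k}^{\beta_k}$. Put $[n]=\{1,\dots,n\}$, $[0]=\emptyset$. For $S=\{i_1<\dots<i_k\}\subset[n]$ let $M_S=M_{(i_1,i_2-i_1,\dots,i_k-i_{k-1},n+1-i_k)}$ (with $M_\emptyset=M_{(n+1)}$) and $F_S=\sum_{S\subset T\subset[n]}M_T$; each family (over $S\subset[n]$) is a basis of the space $\mathcal{Q}_{n+1}$ of homogeneous quasisymmetric functions of degree $n+1$ over $\mathbb{Q}$. $S\subset[n]$ is left sparse if $1\notin S$ and $i\in S\Rightarrow i-1\notin S$. For such $S$, $\Theta_S=\sum_{T\subset[n]:\,S\subset T\cup(T+1)}2^{|T|+1}M_T$, where $T+1=\{i+1:i\in T\}$. The peak algebra $\Pi$ is the algebra generated by all $\Theta_S$ ($n\ge0$), and $\Pi_{n+1}=\Pi\cap\mathcal{Q}_{n+1}$ has the $\Theta_S$, $S\subset[n]$ left sparse, as a basis; nonnegativity refers to coefficients in this basis. For $S\subset[n]$, $\Lambda(S)=\{i\in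 S:i\ne1,\ i-1\notin S\}$. The linear map $\vartheta$ is defined on $\mathcal{Q}_{n+1}$ by $\vartheta(F_S)=\Theta_{\Lambda(S)}$ for $S\subset[n]$. The peak set of a permutation $\pi\in S_{n+1}$ is $\{i: 2\le i\le n,\ \pi(i-1)<\pi(i)>\pi(i+1)\}$. *)

theory Defs
  imports
    Complex_Main
    "HOL-Library.Poly_Mapping"
    "HOL-Library.Function_Algebras"
    "HOL-Combinatorics.Permutations"
begin

section \<open>Formal power series over the rationals in countably many variables\<close>

text \<open>
  The variables are indexed by \<^typ>\<open>nat\<close> (starting at 0; only the order type matters), a monomial
  is its exponent vector, and a power series is the function giving its coefficients.
  Sums, zero and negation of power series are the pointwise ones of Function_Algebras. The product
  of power series is \<open>qmult\<close> below; the operation \<^term>\<open>(*)\<close> on functions is pointwise and is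
  not used.
\<close>

type_synonym qseries = "(nat \<Rightarrow>\<^sub>0 nat) \<Rightarrow> rat"

definition qscale :: "rat \<Rightarrow> qseries \<Rightarrow> qseries"  (infixr "*\<^sub>q" 75)
  where "c *\<^sub>q f = (\<lambda>m. c * f m)"

definition qone :: qseries
  where "qone = (\<lambda>m. of_bool (m = 0))"

definition qmult :: "qseries \<Rightarrow> qseries \<Rightarrow> qseries"
  where "qmult f g = (\<lambda>m. \<Sum>(a, b) \<in> {(a, b). a + b = m}. f a * g b)"

global_interpretation qv: vector_space qscale
  by unfold_locales (auto simp: qscale_def algebra_simps)

lemma finite_add_eq: "finite {(a, b). a + b = (m :: nat \<Rightarrow>\<^sub>0 nat)}"
proof -
  define K where "K = Poly_Mapping.keys m"
  define N where "N = (\<Sum>i\<in>K. Poly_Mapping.lookup m i)"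
  have K: "finite K" by (simp add: K_def)
  let ?G = "{f. \<forall>i. (i \<in> K \<longrightarrow> f i \<in> {..N}) \<and> (i \<notin> K \<longrightarrow> f i = (0::nat))}"
  have G: "finite ?G"
    by (rule finite_set_of_finite_funs[OF K]) simp
  have "Poly_Mapping.lookup a \<in> ?G" if "a + b = m" for a b
  proof -
    have le: "Poly_Mapping.lookup a i \<le> Poly_Mapping.lookup m i" for i
      using that by (auto simp: lookup_add)
    have "Poly_Mapping.lookup a i \<le> N" if "i \<in> K" for i
      unfolding N_def
      using le[of i] member_le_sum[OF that _ K, of "Poly_Mapping.lookup m"] by simp
    moreover have "Poly_Mapping.lookup a i = 0" if "i \<notin> K" for i
      using that le[of i] by (simp add: K_def in_keys_iff)
    ultimately show ?thesis by simp
  qed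
  hence "Poly_Mapping.lookup ` {a. \<exists>b. a + b = m} \<subseteq> ?G" by auto
  hence "finite (Poly_Mapping.lookup ` {a. \<exists>b. a + b = m})"
    using G finite_subset by blast
  hence fin: "finite {a. \<exists>b. a + b = m}"
    by (rule finite_imageD) (simp add: inj_on_def poly_mapping_eqI)
  have "{(a, b). a + b = m} \<subseteq> (\<lambda>a. (a, m - a)) ` {a. \<exists>b. a + b = m}"
    by (auto simp: image_iff)
  thus ?thesis using fin by (meson finite_imageI finite_subset)
qed


section \<open>Quasisymmetric functions\<close>

definition composition :: "nat list \<Rightarrow> bool"
  where "composition \<beta> \<longleftrightarrow> (\<forall>b \<in> set \<beta>. 0 < b)"

definition mon :: "nat list \<Rightarrow> nat list \<Rightarrow> (nat \<Rightarrow>\<^sub>0 nat)"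
  where "mon is \<beta> = (\<Sum>(i, b) \<leftarrow> zip is \<beta>. Poly_Mapping.single i b)"

definition index_seq :: "nat list \<Rightarrow> nat \<Rightarrow> bool"
  where "index_seq is k \<longleftrightarrow> sorted_wrt (<) is \<and> length is = k"

definition mon_degree :: "(nat \<Rightarrow>\<^sub>0 nat) \<Rightarrow> nat"
  where "mon_degree m = (\<Sum>i \<in> Poly_Mapping.keys m. Poly_Mapping.lookup m i)"

definition QSym :: "nat \<Rightarrow> qseries set"
  where "QSym d = {f.
    (\<forall>m. f m \<noteq> 0 \<longrightarrow> mon_degree m = d) \<and>
    (\<forall>\<beta> is js. composition \<beta> \<and> index_seq is (length \<beta>) \<and> index_seq js (length \<beta>)
       \<longrightarrow> f (mon is \<beta>) = f (mon js \<beta>))}"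

text \<open>
  The monomial quasisymmetric function. All its coefficients are 0 or 1: as the parts of a
  composition are positive, a monomial arises from at most one increasing index sequence.
\<close>

definition M_comp :: "nat list \<Rightarrow> qseries"
  where "M_comp \<beta> = (\<lambda>m. of_bool (\<exists>is. index_seq is (length \<beta>) \<and> m = mon is \<beta>))"

fun differences :: "nat \<Rightarrow> nat list \<Rightarrow> nat list" where
  "differences a [] = []"
| "differences a (x # xs) = (x - a) # differences x xs"

text \<open>In what follows \<open>n\<close> is the size of the ground set \<open>[n]\<close>; the series indexed by \<open>n\<close> have degree
  \<open>n + 1\<close> (so \<open>peak_element n\<close> is \<open>p\<^bsub>n+1\<^esub>\<close>).\<close>

definition comp_of :: "nat \<Rightarrow> nat set \<Rightarrow> nat list"
  where "comp_of n S = differences 0 (sorted_list_of_set S @ [n + 1])"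

definition M_qsym :: "nat \<Rightarrow> nat set \<Rightarrow> qseries"
  where "M_qsym n S = M_comp (comp_of n S)"

definition F_qsym :: "nat \<Rightarrow> nat set \<Rightarrow> qseries"
  where "F_qsym n S = (\<Sum>T \<in> {T. S \<subseteq> T \<and> T \<subseteq> {1..n}}. M_qsym n T)"


section \<open>The peak algebra\<close>

definition left_sparse :: "nat set \<Rightarrow> bool"
  where "left_sparse S \<longleftrightarrow> 1 \<notin> S \<and> (\<forall>i \<in> S. i - 1 \<notin> S)"

definition left_sparse_sets :: "nat \<Rightarrow> nat set set"
  where "left_sparse_sets n = {S. S \<subseteq> {1..n} \<and> left_sparse S}"

definition Theta :: "nat \<Rightarrow> nat set \<Rightarrow> qseries"
  where "Theta n S = (\<Sum>T \<in> {T. T \<subseteq> {1..n} \<and> S \<subseteq> T \<union> Suc ` T}. 2 ^ (card T + 1) *\<^sub>q M_qsym n T)"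

inductive_set peak_algebra :: "qseries set" where
  one: "qone \<in> peak_algebra"
| generator: "S \<in> left_sparse_sets n \<Longrightarrow> Theta n S \<in> peak_algebra"
| add: "f \<in> peak_algebra \<Longrightarrow> g \<in> peak_algebra \<Longrightarrow> f + g \<in> peak_algebra"
| scale: "f \<in> peak_algebra \<Longrightarrow> c *\<^sub>q f \<in> peak_algebra"
| mult: "f \<in> peak_algebra \<Longrightarrow> g \<in> peak_algebra \<Longrightarrow> qmult f g \<in> peak_algebra"

definition peak_component :: "nat \<Rightarrow> qseries set"
  where "peak_component d = peak_algebra \<inter> QSym d"

text \<open>
  As the \<open>Theta n S\<close> with left sparse \<open>S \<subseteq> [n]\<close> form a basis, the coefficients \<open>c\<close> are unique.
\<close>

definition Theta_nonneg :: "nat \<Rightarrow> qseries \<Rightarrow> bool"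
  where "Theta_nonneg n f \<longleftrightarrow>
    (\<exists>c. (\<forall>S \<in> left_sparse_sets n. 0 \<le> c S) \<and> f = (\<Sum>S \<in> left_sparse_sets n. c S *\<^sub>q Theta n S))"


section \<open>The linear map\<close>

definition Lam :: "nat set \<Rightarrow> nat set"
  where "Lam S = {i \<in> S. i \<noteq> 1 \<and> i - 1 \<notin> S}"

text \<open>
  \<^term>\<open>qv.representation B f b\<close> is the coefficient of \<open>b\<close> in the expansion of \<open>f\<close> in the
  basis \<open>B\<close>. The lemmas \<open>span_F\<close>, \<open>vartheta_F\<close>, \<open>vartheta_add\<close> and \<open>vartheta_scale\<close> below show
  that on \<^term>\<open>QSym (n + 1)\<close> this is the linear map with \<open>F_qsym n S \<mapsto> Theta n (Lam S)\<close>.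
\<close>

definition vartheta :: "nat \<Rightarrow> qseries \<Rightarrow> qseries"
  where "vartheta n f =
    (\<Sum>S \<in> Pow {1..n}. qv.representation (F_qsym n ` Pow {1..n}) f (F_qsym n S) *\<^sub>q Theta n (Lam S))"


section \<open>Peak sets\<close>

definition peak_set :: "nat \<Rightarrow> (nat \<Rightarrow> nat) \<Rightarrow> nat set"
  where "peak_set n \<pi> = {i. 2 \<le> i \<and> i \<le> n \<and> \<pi> (i - 1) < \<pi> i \<and> \<pi> i > \<pi> (i + 1)}"

definition peak_number :: "nat \<Rightarrow> nat set \<Rightarrow> nat"
  where "peak_number n S = card {\<pi>. \<pi> permutes {1..n + 1} \<and> peak_set n \<pi> = S}"

definition peak_element :: "nat \<Rightarrow> qseries"
  where "peak_element n = (\<Sum>S \<in> left_sparse_sets n. of_nat (peak_number n S) *\<^sub>q Theta n S)"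

section \<open>Well-definedness of the linear map\<close>

subsection \<open>Compositions and subsets\<close>

fun psums :: "nat \<Rightarrow> nat list \<Rightarrow> nat list" where
  "psums a [] = []"
| "psums a (d # ds) = (a + d) # psums (a + d) ds"

lemma psums_diffs: "sorted (a # xs) \<Longrightarrow> psums a (differences a xs) = xs"
  by (induction xs arbitrary: a) auto

lemma diffs_psums: "differences a (psums a ds) = ds"
  by (induction ds arbitrary: a) auto

lemma length_diffs [simp]: "length (differences a xs) = length xs"
  by (induction xs arbitrary: a) auto

lemma composition_diffs: "sorted_wrt (<) (a # xs) \<Longrightarrow> composition (differences a xs)"
  by (induction xs arbitrary: a) (auto simp: composition_def)

lemma sum_list_diffs: "sorted (a # xs) \<Longrightarrow> a + sum_list (differences a xs) = last (a # xs)"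
proof (induction xs arbitrary: a)
  case (Cons x xs)
  hence "x + sum_list (differences x xs) = last (x # xs)" "a \<le> x" by simp_all
  thus ?case by (simp del: last.simps add: last_ConsR)
qed simp

lemma sorted_psums: "composition ds \<Longrightarrow> sorted_wrt (<) (a # psums a ds)"
proof (induction ds arbitrary: a)
  case (Cons d ds)
  have "composition ds" and d: "0 < d"
    using Cons.prems by (simp_all add: composition_def)
  hence "sorted_wrt (<) ((a + d) # psums (a + d) ds)"
    by (intro Cons.IH)
  with d show ?case by auto
qed auto

lemma last_psums: "last (a # psums a ds) = a + sum_list ds"
proof (induction ds arbitrary: a)
  case (Cons d ds)
  show ?case using Cons[of "a + d"] by (simp del: last.simps add: last_ConsR)
qed simp

lemma sorted_comp_of:
  fixes n :: nat
  assumes "S \<subseteq> {1..n}"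
  shows "sorted_wrt (<) (0 # sorted_list_of_set S @ [n + 1])"
proof -
  have "finite S" using finite_subset[OF assms] by simp
  hence "set (sorted_list_of_set S) = S" by simp
  moreover have "sorted_wrt (<) (sorted_list_of_set S)" by simp
  moreover have "\<forall>x\<in>S. 0 < x \<and> x < n + 1" using assms by fastforce
  ultimately show ?thesis by (simp add: sorted_wrt_append)
qed

lemma composition_comp_of: "S \<subseteq> {1..n} \<Longrightarrow> composition (comp_of n S)"
  unfolding comp_of_def by (rule composition_diffs[OF sorted_comp_of])

lemma strict_imp_sorted: "sorted_wrt (<) (xs :: nat list) \<Longrightarrow> sorted xs"
  using strict_sorted_iff by blast

lemma sum_list_comp_of: "S \<subseteq> {1..n} \<Longrightarrow> sum_list (comp_of n S) = n + 1"
  using sum_list_diffs[OF strict_imp_sorted[OF sorted_comp_of[of S n]]]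
  by (simp add: comp_of_def)

lemma psums_comp_of: "S \<subseteq> {1..n} \<Longrightarrow> psums 0 (comp_of n S) = sorted_list_of_set S @ [n + 1]"
  unfolding comp_of_def by (intro psums_diffs strict_imp_sorted sorted_comp_of)

lemma comp_of_inj:
  assumes "S \<subseteq> {1..n}" "T \<subseteq> {1..n}" "comp_of n S = comp_of n T"
  shows "S = T"
proof -
  have "sorted_list_of_set S = sorted_list_of_set T"
    using psums_comp_of[OF assms(1)] psums_comp_of[OF assms(2)] assms(3) by simp
  moreover have "finite S" "finite T" using finite_subset[OF assms(1)] finite_subset[OF assms(2)] by simp_all
  ultimately show ?thesis by (metis set_sorted_list_of_set)
qed

lemma comp_of_surj:
  assumes "composition \<beta>" "sum_list \<beta> = n + 1"
  obtains S where "S \<subseteq> {1..n}" "comp_of n S = \<beta>"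
proof -
  let ?p = "psums 0 \<beta>"
  have "\<beta> \<noteq> []" using assms by auto
  hence ne: "?p \<noteq> []" by (cases \<beta>) auto
  have l: "last ?p = n + 1" using last_psums[of 0 \<beta>] assms ne by simp
  have p: "?p = butlast ?p @ [n + 1]" using l ne by (metis append_butlast_last_id)
  have s: "sorted_wrt (<) (0 # butlast ?p @ [n + 1])"
    using sorted_psums[OF assms(1), of 0] p by simp
  let ?S = "set (butlast ?p)"
  have "?S \<subseteq> {1..n}" using s by (force simp: sorted_wrt_append)
  moreover have "sorted_list_of_set ?S = butlast ?p"
    using s by (simp add: sorted_wrt_append sorted_list_of_set.idem_if_sorted_distinct strict_sorted_iff)
  hence "comp_of n ?S = \<beta>" unfolding comp_of_def using p diffs_psums[of 0 \<beta>] by simp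
  ultimately show thesis using that by blast
qed

subsection \<open>Monomials\<close>

lemma lookup_mon_notin: "i \<notin> set is \<Longrightarrow> Poly_Mapping.lookup (mon is \<beta>) i = 0"
proof (induction "is" arbitrary: \<beta>)
  case (Cons a "is")
  thus ?case by (cases \<beta>) (auto simp: mon_def lookup_add lookup_single)
qed (auto simp: mon_def)

lemma map_lookup_mon:
  "distinct is \<Longrightarrow> length is = length \<beta> \<Longrightarrow> map (Poly_Mapping.lookup (mon is \<beta>)) is = \<beta>"
proof (induction "is" arbitrary: \<beta>)
  case (Cons a "is")
  then obtain b \<beta>' where b: "\<beta> = b # \<beta>'" by (cases \<beta>) auto
  have "Poly_Mapping.lookup (mon is \<beta>') a = 0" using Cons.prems by (intro lookup_mon_notin) auto
  hence "Poly_Mapping.lookup (Poly_Mapping.single a b + mon is \<beta>') a = b" by (simp add: lookup_add)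
  moreover have "map (Poly_Mapping.lookup (mon is \<beta>')) is = \<beta>'" using Cons b by auto
  moreover have "mon (a # is) \<beta> = Poly_Mapping.single a b + mon is \<beta>'"
    by (simp add: mon_def b)
  moreover have "map (Poly_Mapping.lookup (Poly_Mapping.single a b + mon is \<beta>')) is = map (Poly_Mapping.lookup (mon is \<beta>')) is"
    using Cons.prems by (auto simp: lookup_add lookup_single when_def)
  ultimately show ?case by (simp add: b)
qed auto

lemma keys_mon:
  assumes "distinct is" "length is = length \<beta>" "composition \<beta>"
  shows "Poly_Mapping.keys (mon is \<beta>) = set is"
proof
  show "Poly_Mapping.keys (mon is \<beta>) \<subseteq> set is"
    using lookup_mon_notin by (auto simp: in_keys_iff)
  show "set is \<subseteq> Poly_Mapping.keys (mon is \<beta>)"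
  proof
    fix i assume "i \<in> set is"
    hence "Poly_Mapping.lookup (mon is \<beta>) i \<in> set (map (Poly_Mapping.lookup (mon is \<beta>)) is)" by auto
    hence "Poly_Mapping.lookup (mon is \<beta>) i \<in> set \<beta>" using map_lookup_mon[OF assms(1,2)] by simp
    thus "i \<in> Poly_Mapping.keys (mon is \<beta>)" using assms(3) by (auto simp: composition_def in_keys_iff)
  qed
qed

lemma index_seq_distinct: "index_seq is k \<Longrightarrow> distinct is"
  unfolding index_seq_def using strict_sorted_iff by blast

lemma mon_inj:
  assumes "index_seq is (length \<beta>)" "index_seq js (length \<gamma>)" "composition \<beta>" "composition \<gamma>"
    and eq: "mon is \<beta> = mon js \<gamma>"
  shows "is = js \<and> \<beta> = \<gamma>"
proof -
  note d = index_seq_distinct[OF assms(1)] index_seq_distinct[OF assms(2)]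
  have l: "length is = length \<beta>" "length js = length \<gamma>"
    using assms by (auto simp: index_seq_def)
  have "set is = set js"
    using keys_mon[OF d(1) l(1) assms(3)] keys_mon[OF d(2) l(2) assms(4)] eq by simp
  moreover have "sorted_wrt (<) is" "sorted_wrt (<) js"
    using assms(1,2) by (simp_all add: index_seq_def)
  ultimately have 1: "is = js" by (metis strict_sorted_equal)
  have "\<beta> = map (Poly_Mapping.lookup (mon js \<gamma>)) is"
    unfolding eq[symmetric] by (rule map_lookup_mon[OF d(1) l(1), symmetric])
  also have "\<dots> = \<gamma>" unfolding 1 by (rule map_lookup_mon[OF d(2) l(2)])
  finally show ?thesis using 1 by blast
qed

lemma mon_degree_mon:
  assumes "index_seq is (length \<beta>)" "composition \<beta>"
  shows "mon_degree (mon is \<beta>) = sum_list \<beta>"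
proof -
  note d = index_seq_distinct[OF assms(1)]
  have l: "length is = length \<beta>" using assms by (auto simp: index_seq_def)
  have "mon_degree (mon is \<beta>) = (\<Sum>i \<in> set is. Poly_Mapping.lookup (mon is \<beta>) i)"
    unfolding mon_degree_def keys_mon[OF d l assms(2)] ..
  also have "\<dots> = sum_list (map (Poly_Mapping.lookup (mon is \<beta>)) is)"
    using d by (simp add: sum_list_distinct_conv_sum_set)
  finally show ?thesis using map_lookup_mon[OF d l] by simp
qed

lemma ex_mon:
  obtains "is" \<beta> where "index_seq is (length \<beta>)" "composition \<beta>" "m = mon is \<beta>"
proof -
  let ?is = "sorted_list_of_set (Poly_Mapping.keys m)"
  let ?\<beta> = "map (Poly_Mapping.lookup m) ?is"
  have i: "index_seq ?is (length ?\<beta>)" by (simp add: index_seq_def)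
  have c: "composition ?\<beta>" by (auto simp: composition_def in_keys_iff)
  have d: "distinct ?is" by simp
  have "m = mon ?is ?\<beta>"
  proof (rule poly_mapping_eqI)
    fix k
    show "Poly_Mapping.lookup m k = Poly_Mapping.lookup (mon ?is ?\<beta>) k"
    proof (cases "k \<in> Poly_Mapping.keys m")
      case True
      have "map (Poly_Mapping.lookup (mon ?is ?\<beta>)) ?is = map (Poly_Mapping.lookup m) ?is"
        using map_lookup_mon[OF d, of ?\<beta>] by simp
      thus ?thesis using True by (simp add: map_eq_conv)
    next
      case False
      thus ?thesis using lookup_mon_notin[of k ?is ?\<beta>] by (simp add: in_keys_iff)
    qed
  qed
  from that[OF i c this] show thesis .
qed

lemma M_mon:
  assumes "index_seq is (length \<beta>)" "composition \<beta>" "S \<subseteq> {1..n}"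
  shows "M_qsym n S (mon is \<beta>) = of_bool (\<beta> = comp_of n S)"
proof -
  have "(\<exists>js. index_seq js (length (comp_of n S)) \<and> mon is \<beta> = mon js (comp_of n S)) \<longleftrightarrow> \<beta> = comp_of n S"
    using mon_inj[OF assms(1) _ assms(2) composition_comp_of[OF assms(3)]] assms(1) by blast
  thus ?thesis by (simp add: M_qsym_def M_comp_def)
qed

lemma QSymI:
  assumes "\<And>m. f m \<noteq> 0 \<Longrightarrow> mon_degree m = d"
    and "\<And>\<beta> is js. \<lbrakk>composition \<beta>; index_seq is (length \<beta>); index_seq js (length \<beta>)\<rbrakk>
      \<Longrightarrow> f (mon is \<beta>) = f (mon js \<beta>)"
  shows "f \<in> QSym d"
  unfolding QSym_def using assms by blast

lemma QSym_degree: "f \<in> QSym d \<Longrightarrow> f m \<noteq> 0 \<Longrightarrow> mon_degree m = d"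
  unfolding QSym_def by blast

lemma QSym_shift:
  assumes "f \<in> QSym d" "composition \<beta>" "index_seq is (length \<beta>)" "index_seq js (length \<beta>)"
  shows "f (mon is \<beta>) = f (mon js \<beta>)"
  using assms unfolding QSym_def by blast

lemma M_in_QSym:
  assumes "S \<subseteq> {1..n}"
  shows "M_qsym n S \<in> QSym (n + 1)"
proof -
  have "mon_degree m = n + 1" if "M_qsym n S m \<noteq> 0" for m
  proof -
    obtain "is" where "index_seq is (length (comp_of n S))" "m = mon is (comp_of n S)"
      using \<open>M_qsym n S m \<noteq> 0\<close> by (auto simp: M_qsym_def M_comp_def)
    thus ?thesis
      using mon_degree_mon composition_comp_of[OF assms] sum_list_comp_of[OF assms] by metis
  qed
  thus ?thesis by (intro QSymI) (simp_all add: M_mon[OF _ _ assms])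
qed

lemma subspace_QSym: "qv.subspace (QSym d)"
proof (rule qv.subspaceI)
  show "0 \<in> QSym d" by (rule QSymI) simp_all
next
  fix f g assume f: "f \<in> QSym d" and g: "g \<in> QSym d"
  show "f + g \<in> QSym d"
  proof (rule QSymI)
    fix m assume "(f + g) m \<noteq> 0"
    hence "f m \<noteq> 0 \<or> g m \<noteq> 0" by auto
    thus "mon_degree m = d" using QSym_degree[OF f] QSym_degree[OF g] by blast
  next
    fix \<beta> "is" js assume "composition \<beta>" "index_seq is (length \<beta>)" "index_seq js (length \<beta>)"
    from QSym_shift[OF f this] QSym_shift[OF g this]
    show "(f + g) (mon is \<beta>) = (f + g) (mon js \<beta>)" by simp
  qed
next
  fix f c assume f: "f \<in> QSym d"
  show "c *\<^sub>q f \<in> QSym d"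
  proof (rule QSymI)
    fix m assume "(c *\<^sub>q f) m \<noteq> 0"
    thus "mon_degree m = d" by (intro QSym_degree[OF f]) (simp add: qscale_def)
  next
    fix \<beta> "is" js assume "composition \<beta>" "index_seq is (length \<beta>)" "index_seq js (length \<beta>)"
    from QSym_shift[OF f this] show "(c *\<^sub>q f) (mon is \<beta>) = (c *\<^sub>q f) (mon js \<beta>)"
      by (simp add: qscale_def)
  qed
qed

lemma sum_qseries_apply: "(\<Sum>x\<in>A. (g x :: qseries)) m = (\<Sum>x\<in>A. g x m)"
  by (induction A rule: infinite_finite_induct) auto

lemma QSym_M_expansion:
  assumes "f \<in> QSym (n + 1)"
  shows "f = (\<Sum>T\<in>Pow {1..n}. f (mon [0..<length (comp_of n T)] (comp_of n T)) *\<^sub>q M_qsym n T)"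
proof
  fix m
  let ?c = "\<lambda>T. f (mon [0..<length (comp_of n T)] (comp_of n T))"
  obtain "is" \<beta> where m: "index_seq is (length \<beta>)" "composition \<beta>" "m = mon is \<beta>"
    by (rule ex_mon)
  have rhs: "(\<Sum>T\<in>Pow {1..n}. ?c T *\<^sub>q M_qsym n T) m
      = (\<Sum>T\<in>Pow {1..n}. ?c T * of_bool (\<beta> = comp_of n T))"
    unfolding sum_qseries_apply qscale_def using M_mon[OF m(1,2)] m(3) by (intro sum.cong) auto
  show "f m = (\<Sum>T\<in>Pow {1..n}. ?c T *\<^sub>q M_qsym n T) m"
  proof (cases "sum_list \<beta> = n + 1")
    case True
    then obtain S where S: "S \<subseteq> {1..n}" "comp_of n S = \<beta>"
      by (rule comp_of_surj[OF m(2)])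
    have "(\<Sum>T\<in>Pow {1..n}. ?c T * of_bool (\<beta> = comp_of n T))
        = (\<Sum>T\<in>Pow {1..n}. if T = S then ?c T else 0)"
    proof (intro sum.cong refl)
      fix T assume "T \<in> Pow {1..n}"
      hence "T \<subseteq> {1..n}" by simp
      hence "\<beta> = comp_of n T \<longleftrightarrow> T = S"
        unfolding S(2)[symmetric] using comp_of_inj[OF _ S(1)] by metis
      thus "?c T * of_bool (\<beta> = comp_of n T) = (if T = S then ?c T else 0)" by simp
    qed
    also have "\<dots> = ?c S" using S by simp
    also have "\<dots> = f m"
    proof -
      have "index_seq [0..<length \<beta>] (length \<beta>)" by (simp add: index_seq_def)
      from QSym_shift[OF assms m(2) this m(1)] show ?thesis
        unfolding m(3) S(2) .
    qed
    finally show ?thesis using rhs by simp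
  next
    case False
    hence "f m = 0" using QSym_degree[OF assms, of m] mon_degree_mon[OF m(1,2)] m(3) by metis
    moreover have "\<beta> \<noteq> comp_of n T" if "T \<in> Pow {1..n}" for T
      using that False sum_list_comp_of by auto
    ultimately show ?thesis using rhs by simp
  qed
qed

lemma F_mon:
  assumes "T \<subseteq> {1..n}"
  shows "F_qsym n S (mon [0..<length (comp_of n T)] (comp_of n T)) = of_bool (S \<subseteq> T)"
proof -
  have "index_seq [0..<length (comp_of n T)] (length (comp_of n T))" by (simp add: index_seq_def)
  note M = M_mon[OF this composition_comp_of[OF assms]]
  have fin: "finite {U. S \<subseteq> U \<and> U \<subseteq> {1..n}}"
    by (rule finite_subset[of _ "Pow {1..n}"]) auto
  have "F_qsym n S (mon [0..<length (comp_of n T)] (comp_of n T))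
      = (\<Sum>U\<in>{U. S \<subseteq> U \<and> U \<subseteq> {1..n}}. of_bool (U = T))"
    unfolding F_qsym_def sum_qseries_apply
  proof (intro sum.cong refl)
    fix U assume "U \<in> {U. S \<subseteq> U \<and> U \<subseteq> {1..n}}"
    hence U: "U \<subseteq> {1..n}" by simp
    have "comp_of n T = comp_of n U \<longleftrightarrow> U = T" using comp_of_inj[OF U assms] by metis
    thus "M_qsym n U (mon [0..<length (comp_of n T)] (comp_of n T)) = of_bool (U = T)"
      using M[OF U] by simp
  qed
  also have "\<dots> = of_bool (S \<subseteq> T)" using fin assms by (simp add: of_bool_def)
  finally show ?thesis .
qed

lemma F_inj: "inj_on (F_qsym n) (Pow {1..n})"
proof (rule inj_onI)
  fix S T assume ST: "S \<in> Pow {1..n}" "T \<in> Pow {1..n}" and eq: "F_qsym n S = F_qsym n T"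
  have "S \<subseteq> T" using F_mon[of T n S] F_mon[of T n T] ST eq by (simp add: of_bool_def split: if_splits)
  moreover have "T \<subseteq> S" using F_mon[of S n S] F_mon[of S n T] ST eq by (simp add: of_bool_def split: if_splits)
  ultimately show "S = T" by blast
qed

lemma F_independent: "\<not> qv.dependent (F_qsym n ` Pow {1..n})"
proof -
  have "\<forall>v\<in>F_qsym n ` Pow {1..n}. u v = 0"
    if 0: "(\<Sum>v\<in>F_qsym n ` Pow {1..n}. u v *\<^sub>q v) = 0" for u
  proof -
    have 1: "(\<Sum>S\<in>Pow {1..n}. u (F_qsym n S) *\<^sub>q F_qsym n S) = 0"
      using 0 by (subst (asm) sum.reindex[OF F_inj]) simp
    have 2: "(\<Sum>S\<in>Pow T. u (F_qsym n S)) = 0" if "T \<subseteq> {1..n}" for T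
    proof -
      let ?m = "mon [0..<length (comp_of n T)] (comp_of n T)"
      have "0 = (\<Sum>S\<in>Pow {1..n}. u (F_qsym n S) *\<^sub>q F_qsym n S) ?m" using 1 by simp
      also have "\<dots> = (\<Sum>S\<in>Pow {1..n}. u (F_qsym n S) * of_bool (S \<subseteq> T))"
        unfolding sum_qseries_apply qscale_def using F_mon[OF that] by simp
      also have "\<dots> = (\<Sum>S\<in>Pow T. u (F_qsym n S))"
        using that by (intro sum.mono_neutral_cong_right) auto
      finally show ?thesis by simp
    qed
    have "u (F_qsym n T) = 0" if "T \<subseteq> {1..n}" for T
      using finite_subset[OF that finite_atLeastAtMost] that
    proof (induction T rule: finite_psubset_induct)
      case (psubset T)
      have "(\<Sum>S\<in>Pow T. u (F_qsym n S)) = u (F_qsym n T) + (\<Sum>S\<in>Pow T - {T}. u (F_qsym n S))"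
        using psubset.hyps by (intro sum.remove) auto
      moreover have "(\<Sum>S\<in>Pow T - {T}. u (F_qsym n S)) = 0"
        using psubset by (intro sum.neutral) blast
      ultimately show ?case using 2[OF psubset.prems] by simp
    qed
    thus ?thesis by auto
  qed
  thus ?thesis by (subst qv.dependent_finite) auto
qed

lemma M_in_span_F:
  assumes "S \<subseteq> {1..n}"
  shows "M_qsym n S \<in> qv.span (F_qsym n ` Pow {1..n})"
  using assms
proof (induction "card ({1..n} - S)" arbitrary: S rule: less_induct)
  case less
  let ?A = "{T. S \<subseteq> T \<and> T \<subseteq> {1..n}}"
  have fin: "finite ?A" by (rule finite_subset[of _ "Pow {1..n}"]) auto
  have "F_qsym n S = M_qsym n S + (\<Sum>T\<in>?A - {S}. M_qsym n T)"
    unfolding F_qsym_def using less.prems fin by (intro sum.remove) auto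
  hence "M_qsym n S = F_qsym n S - (\<Sum>T\<in>?A - {S}. M_qsym n T)" by (simp only: add_diff_cancel_right')
  moreover have "F_qsym n S \<in> qv.span (F_qsym n ` Pow {1..n})"
    using less.prems by (intro qv.span_base) auto
  moreover have "(\<Sum>T\<in>?A - {S}. M_qsym n T) \<in> qv.span (F_qsym n ` Pow {1..n})"
  proof (rule qv.span_sum)
    fix T assume T: "T \<in> ?A - {S}"
    have "{1..n} - T \<subset> {1..n} - S" using T by blast
    hence "card ({1..n} - T) < card ({1..n} - S)" by (intro psubset_card_mono) auto
    thus "M_qsym n T \<in> qv.span (F_qsym n ` Pow {1..n})" using less.hyps T by blast
  qed
  ultimately show ?case by (simp only: qv.span_diff)
qed

lemma span_F: "qv.span (F_qsym n ` Pow {1..n}) = QSym (n + 1)"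
proof
  have "F_qsym n S \<in> QSym (n + 1)" for S
    unfolding F_qsym_def using M_in_QSym by (intro qv.subspace_sum[OF subspace_QSym]) auto
  thus "qv.span (F_qsym n ` Pow {1..n}) \<subseteq> QSym (n + 1)"
    by (intro qv.span_minimal subspace_QSym) auto
  show "QSym (n + 1) \<subseteq> qv.span (F_qsym n ` Pow {1..n})"
  proof
    fix f assume "f \<in> QSym (n + 1)"
    show "f \<in> qv.span (F_qsym n ` Pow {1..n})"
      by (subst QSym_M_expansion[OF \<open>f \<in> QSym (n + 1)\<close>])
        (intro qv.span_sum qv.span_scale M_in_span_F, simp)
  qed
qed

lemma vartheta_F:
  assumes "S \<subseteq> {1..n}"
  shows "vartheta n (F_qsym n S) = Theta n (Lam S)"
proof -
  have "vartheta n (F_qsym n S) = (\<Sum>T\<in>Pow {1..n}. if T = S then Theta n (Lam T) else 0)"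
    unfolding vartheta_def
  proof (intro sum.cong refl)
    fix T assume T: "T \<in> Pow {1..n}"
    have "F_qsym n S \<in> F_qsym n ` Pow {1..n}" using assms by (intro imageI PowI)
    from qv.representation_basis[OF F_independent this]
    have "qv.representation (F_qsym n ` Pow {1..n}) (F_qsym n S) (F_qsym n T) = of_bool (F_qsym n T = F_qsym n S)"
      by (simp only: of_bool_def)
    also have "F_qsym n T = F_qsym n S \<longleftrightarrow> T = S"
      by (rule inj_on_eq_iff[OF F_inj T PowI[OF assms]])
    finally show "qv.representation (F_qsym n ` Pow {1..n}) (F_qsym n S) (F_qsym n T) *\<^sub>q Theta n (Lam T)
        = (if T = S then Theta n (Lam T) else 0)" by simp
  qed
  thus ?thesis using assms by simp
qed

lemma vartheta_add:
  assumes "f \<in> QSym (n + 1)" "g \<in> QSym (n + 1)"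
  shows "vartheta n (f + g) = vartheta n f + vartheta n g"
  unfolding vartheta_def qv.representation_add[OF F_independent assms(2,1)[folded span_F]]
    qv.scale_left_distrib sum.distrib ..

lemma vartheta_scale:
  assumes "f \<in> QSym (n + 1)"
  shows "vartheta n (c *\<^sub>q f) = c *\<^sub>q vartheta n f"
  unfolding vartheta_def qv.representation_scale[OF F_independent assms[folded span_F]]
    qv.scale_sum_right qv.scale_scale ..

end

theory Submission
  imports Defs "HOL-Combinatorics.Multiset_Permutations"
begin

text \<open>
  Grouping the permutations by their peak set turns the peak element into the sum of
  \<open>Theta n (Peak \<pi>)\<close> over all permutations \<open>\<pi>\<close>. Let \<open>h\<close>, called \<open>descent_element\<close> below, be the sum of
  \<open>F_qsym n (Des \<pi>)\<close>. A peak is a descent other than 1 that does not follow a descent, that is,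
  \<open>Lam (Des \<pi>) = Peak \<pi>\<close>; hence \<open>vartheta\<close> maps \<open>h\<close> to the peak element. It therefore suffices
  that the peak element is \<open>2 ^ (n + 1)\<close> times \<open>h\<close>: applying \<open>vartheta\<close> to this identity gives the
  eigenvector equation. (The factor is no accident: \<open>h\<close> is the \<open>(n + 1)\<close>-st power of the sum \<open>x\<close>
  of all variables, and \<open>vartheta\<close> is multiplicative with \<open>x \<mapsto> 2 x\<close>.) The identity is proved by
  comparing coefficients.

  The coefficient of \<open>M_qsym n T\<close> in \<open>h\<close> counts the permutations with \<open>Des \<pi> \<subseteq> T\<close>, and in the peak
  element it is \<open>2 ^ (card T + 1)\<close> times the number of those with \<open>Peak \<pi> \<subseteq> T \<union> Suc ` T\<close>.
  Cut the word of \<open>\<pi>\<close> after each position in \<open>T\<close>. A position \<open>i\<close> lies outside \<open>T \<union> Suc ` T\<close> exactly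
  if no cut separates it from its neighbours, so the second condition says that no block has an
  interior peak, while the first says that every block increases. Both kinds of word arise by
  first distributing the values over the blocks and then arranging each block separately. A block
  of size \<open>b\<close> has one increasing arrangement and \<open>2 ^ (b - 1)\<close> arrangements without interior peak,
  and the product of these powers over the \<open>card T + 1\<close> blocks is \<open>2 ^ (n - card T)\<close>. This is
  \<open>card_peak_free_vs_increasing\<close>.
\<close>


section \<open>Arrangements with a prescribed shape between the cuts\<close>

definition hereditary :: "('a list \<Rightarrow> bool) \<Rightarrow> bool"
  where "hereditary P \<longleftrightarrow> (\<forall>xs ys zs. P (xs @ ys @ zs) \<longrightarrow> P ys)"

text \<open>
  Cuts are placed after the positions in \<open>T\<close>, counted from 1. Quantifying over all factors that
  contain no cut, and not only over the maximal ones, avoids listing \<open>T\<close> in order; for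
  hereditary \<open>P\<close> it makes no difference.
\<close>
definition blockwise :: "('a list \<Rightarrow> bool) \<Rightarrow> nat set \<Rightarrow> 'a list \<Rightarrow> bool"
  where "blockwise P T xs \<longleftrightarrow>
    (\<forall>a b. a \<le> b \<longrightarrow> b \<le> length xs \<longrightarrow> T \<inter> {a<..<b} = {} \<longrightarrow> P (drop a (take b xs)))"

definition arrangements :: "('a list \<Rightarrow> bool) \<Rightarrow> nat set \<Rightarrow> 'a set \<Rightarrow> 'a list set"
  where "arrangements P T X = {xs \<in> permutations_of_set X. blockwise P T xs}"

lemma hereditary_sublist:
  assumes "hereditary P" "P xs"
  shows "P (drop a (take b xs))"
proof -
  have "xs = take a (take b xs) @ drop a (take b xs) @ drop b xs"
    by (metis append.assoc append_take_drop_id)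
  thus ?thesis using assms unfolding hereditary_def by metis
qed

lemma blockwise_empty: "hereditary P \<Longrightarrow> blockwise P {} xs \<longleftrightarrow> P xs"
  unfolding blockwise_def using hereditary_sublist[of P xs]
  by (metis Int_empty_left drop0 order_refl take_all zero_le)

text \<open>
  A factor of \<open>ys @ zs\<close> that straddles the junction contains the cut after \<open>ys\<close>, so only factors of
  \<open>ys\<close> and factors of \<open>zs\<close> are constrained. All other cuts lie in \<open>ys\<close>, which leaves \<open>zs\<close> as a
  single block and makes a shift of its positions unnecessary.
\<close>
lemma blockwise_append:
  assumes P: "hereditary P" and A: "A \<subseteq> {..<length ys}"
  shows "blockwise P (insert (length ys) A) (ys @ zs) \<longleftrightarrow> blockwise P A ys \<and> P zs"
proof (intro iffI conjI)
  assume b: "blockwise P (insert (length ys) A) (ys @ zs)"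
  show "blockwise P A ys"
    unfolding blockwise_def
  proof (intro allI impI)
    fix a b assume "a \<le> b" "b \<le> length ys" "A \<inter> {a<..<b} = {}"
    thus "P (drop a (take b ys))"
      using b[unfolded blockwise_def, rule_format, of a b] by simp
  qed
  show "P zs"
    using b[unfolded blockwise_def, rule_format, of "length ys" "length (ys @ zs)"] A by fastforce
next
  assume R: "blockwise P A ys \<and> P zs"
  show "blockwise P (insert (length ys) A) (ys @ zs)"
    unfolding blockwise_def
  proof (intro allI impI)
    fix a b
    assume ab: "a \<le> b" "b \<le> length (ys @ zs)" "insert (length ys) A \<inter> {a<..<b} = {}"
    then consider "b \<le> length ys" | "length ys \<le> a" by fastforce
    thus "P (drop a (take b (ys @ zs)))"
    proof cases
      case 1
      thus ?thesis using R ab by (simp add: blockwise_def)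
    next
      case 2
      thus ?thesis using ab hereditary_sublist[OF P, of zs] R by simp
    qed
  qed
qed

lemma finite_arrangements [simp]: "finite X \<Longrightarrow> finite (arrangements P T X)"
  by (simp add: arrangements_def)

lemma arrangements_empty: "hereditary P \<Longrightarrow> arrangements P {} X = {xs \<in> permutations_of_set X. P xs}"
  by (simp add: arrangements_def blockwise_empty)

text \<open>
  An arrangement that is cut for the last time after position \<open>t\<close> amounts to a choice of the set
  \<open>Y\<close> of its first \<open>t\<close> entries and independent arrangements of \<open>Y\<close> and of the rest. This
  recursion is the same for every shape \<open>P\<close>, so two shapes can be compared block by block.
\<close>
lemma card_arrangements_insert:
  assumes P: "hereditary P" and X: "finite X" and A: "A \<subseteq> {..<t}" and t: "t \<le> card X"
  shows "card (arrangements P (insert t A) X) =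
    (\<Sum>Y | Y \<subseteq> X \<and> card Y = t. card (arrangements P A Y) * card (arrangements P {} (X - Y)))"
proof -
  let ?C = "{Y. Y \<subseteq> X \<and> card Y = t}"
  let ?D = "SIGMA Y:?C. arrangements P A Y \<times> arrangements P {} (X - Y)"
  have "bij_betw (\<lambda>(Y, ys, zs). ys @ zs) ?D (arrangements P (insert t A) X)"
  proof (rule bij_betw_byWitness[where f' = "\<lambda>xs. (set (take t xs), take t xs, drop t xs)"])
    show "(\<lambda>(Y, ys, zs). ys @ zs) ` ?D \<subseteq> arrangements P (insert t A) X"
    proof
      fix w assume "w \<in> (\<lambda>(Y, ys, zs). ys @ zs) ` ?D"
      then obtain Y ys zs where w: "w = ys @ zs" and Y: "Y \<subseteq> X" "card Y = t"
        and ys: "ys \<in> arrangements P A Y" and zs: "zs \<in> arrangements P {} (X - Y)"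
        by auto
      have "length ys = t" using ys Y distinct_card[of ys]
        by (auto simp: arrangements_def permutations_of_set_def)
      moreover have "ys @ zs \<in> permutations_of_set X"
        using ys zs Y by (auto simp: arrangements_def permutations_of_set_def)
      moreover have "blockwise P A ys" "P zs"
        using ys zs by (simp_all add: arrangements_empty[OF P]) (simp add: arrangements_def)
      ultimately show "w \<in> arrangements P (insert t A) X"
        using blockwise_append[OF P, of A ys zs] A by (simp add: arrangements_def w)
    qed
    show "(\<lambda>xs. (set (take t xs), take t xs, drop t xs)) ` arrangements P (insert t A) X \<subseteq> ?D"
    proof
      fix w assume "w \<in> (\<lambda>xs. (set (take t xs), take t xs, drop t xs)) ` arrangements P (insert t A) X"
      then obtain xs where w: "w = (set (take t xs), take t xs, drop t xs)"
        and xs: "xs \<in> arrangements P (insert t A) X" by blast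
      have d: "distinct xs" "set xs = X" using xs by (auto simp: arrangements_def permutations_of_set_def)
      have len: "length xs = card X" using d distinct_card by metis
      have lt: "length (take t xs) = t" using len t by simp
      have bl: "blockwise P A (take t xs) \<and> P (drop t xs)"
        using xs blockwise_append[OF P, of A "take t xs" "drop t xs"] A lt
        by (simp add: arrangements_def)
      have un: "set (take t xs) \<union> set (drop t xs) = X"
        using d(2) by (metis append_take_drop_id set_append)
      have dis: "set (take t xs) \<inter> set (drop t xs) = {}"
        using d(1) by (simp add: set_take_disj_set_drop_if_distinct)
      have "card (set (take t xs)) = t" using d(1) lt distinct_card[of "take t xs"] by simp
      moreover have "X - set (take t xs) = set (drop t xs)" using un dis by blast
      ultimately show "w \<in> ?D"
        using un bl d(1) unfolding w arrangements_empty[OF P]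
        by (auto simp: arrangements_def permutations_of_set_def)
    qed
    show "\<forall>w\<in>?D. (\<lambda>xs. (set (take t xs), take t xs, drop t xs)) ((\<lambda>(Y, ys, zs). ys @ zs) w) = w"
    proof
      fix w assume "w \<in> ?D"
      then obtain Y ys zs where w: "w = (Y, ys, zs)" and Y: "card Y = t"
        and ys: "ys \<in> arrangements P A Y" by auto
      have "length ys = t" "set ys = Y" using ys Y distinct_card[of ys]
        by (auto simp: arrangements_def permutations_of_set_def)
      thus "(\<lambda>xs. (set (take t xs), take t xs, drop t xs)) ((\<lambda>(Y, ys, zs). ys @ zs) w) = w"
        by (simp add: w)
    qed
  qed simp
  hence "card (arrangements P (insert t A) X) = card ?D" by (simp add: bij_betw_same_card)
  also have "\<dots> = (\<Sum>Y\<in>?C. card (arrangements P A Y \<times> arrangements P {} (X - Y)))"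
    using X by (intro card_SigmaI) (auto intro!: finite_cartesian_product finite_arrangements intro: finite_subset)
  finally show ?thesis by (simp add: card_cartesian_product)
qed


section \<open>Increasing blocks and blocks without interior peaks\<close>

abbreviation increasing :: "'a::linorder list \<Rightarrow> bool"
  where "increasing \<equiv> sorted_wrt (<)"

definition peak_free :: "'a::linorder list \<Rightarrow> bool"
  where "peak_free xs \<longleftrightarrow>
    (\<forall>i. i + 2 < length xs \<longrightarrow> \<not> (xs ! i < xs ! (i + 1) \<and> xs ! (i + 2) < xs ! (i + 1)))"

lemma hereditary_increasing: "hereditary increasing"
  by (simp add: hereditary_def sorted_wrt_append)

lemma hereditary_peak_free: "hereditary peak_free"
  unfolding hereditary_def
proof (intro allI impI)
  fix xs ys zs :: "'a list"
  assume p: "peak_free (xs @ ys @ zs)"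
  show "peak_free ys"
    unfolding peak_free_def
  proof (intro allI impI)
    fix i assume "i + 2 < length ys"
    thus "\<not> (ys ! i < ys ! (i + 1) \<and> ys ! (i + 2) < ys ! (i + 1))"
      using p[unfolded peak_free_def, rule_format, of "length xs + i"]
      by (simp add: nth_append add.assoc)
  qed
qed

lemma card_increasing_arrangements:
  assumes "finite X"
  shows "card (arrangements increasing {} (X :: 'a::linorder set)) = 1"
proof -
  have "arrangements increasing {} X = {sorted_list_of_set X}"
    using assms unfolding arrangements_empty[OF hereditary_increasing]
    by (auto simp: permutations_of_set_def strict_sorted_iff
        intro: sorted_list_of_set.idem_if_sorted_distinct[symmetric])
  thus ?thesis by simp
qed

text \<open>
  The maximum of a word without interior peak stands at one of its ends, and a maximum placed at
  an end creates no interior peak. So each new maximum doubles the number of such words, except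
  the very first one, for which the two ends coincide.
\<close>
lemma peak_free_Cons_max:
  assumes "\<forall>x\<in>set xs. x < m"
  shows "peak_free (m # xs) \<longleftrightarrow> peak_free xs"
proof
  show "peak_free (m # xs) \<Longrightarrow> peak_free xs"
    using hereditary_peak_free unfolding hereditary_def by (metis append_Cons append_Nil append_Nil2)
  assume p: "peak_free xs"
  show "peak_free (m # xs)"
    unfolding peak_free_def
  proof (intro allI impI)
    fix i assume i: "i + 2 < length (m # xs)"
    show "\<not> ((m # xs) ! i < (m # xs) ! (i + 1) \<and> (m # xs) ! (i + 2) < (m # xs) ! (i + 1))"
    proof (cases i)
      case 0
      have "xs ! 0 \<in> set xs" using i 0 by (intro nth_mem) auto
      thus ?thesis using 0 assms by fastforce
    next
      case (Suc j)
      thus ?thesis using i p[unfolded peak_free_def, rule_format, of j] by simp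
    qed
  qed
qed

lemma peak_free_snoc_max:
  assumes "\<forall>x\<in>set xs. x < m"
  shows "peak_free (xs @ [m]) \<longleftrightarrow> peak_free xs"
proof
  show "peak_free (xs @ [m]) \<Longrightarrow> peak_free xs"
    using hereditary_peak_free unfolding hereditary_def by (metis append_Nil)
  assume p: "peak_free xs"
  show "peak_free (xs @ [m])"
    unfolding peak_free_def
  proof (intro allI impI)
    fix i assume i: "i + 2 < length (xs @ [m])"
    show "\<not> ((xs @ [m]) ! i < (xs @ [m]) ! (i + 1) \<and> (xs @ [m]) ! (i + 2) < (xs @ [m]) ! (i + 1))"
    proof (cases "i + 2 < length xs")
      case True
      thus ?thesis using p[unfolded peak_free_def, rule_format, of i] by (simp add: nth_append)
    next
      case False
      hence l: "length xs = i + 2" using i by simp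
      hence "xs ! (i + 1) < m" using assms by simp
      thus ?thesis using l by (auto simp: nth_append)
    qed
  qed
qed

lemma peak_free_max_at_end:
  assumes p: "peak_free (us @ m # vs)" and m: "\<forall>x\<in>set us \<union> set vs. x < m"
  shows "us = [] \<or> vs = []"
proof (rule ccontr)
  assume "\<not> (us = [] \<or> vs = [])"
  then obtain us' u v vs' where e: "us = us' @ [u]" "vs = v # vs'"
    by (metis list.exhaust rev_exhaust)
  have "us @ m # vs = us' @ [u, m, v] @ vs'" by (simp add: e)
  hence "peak_free [u, m, v]" using p hereditary_peak_free unfolding hereditary_def by metis
  from this[unfolded peak_free_def, rule_format, of 0] show False using m e by simp
qed

lemma card_peak_free_arrangements:
  assumes "finite X" "X \<noteq> {}"
  shows "card (arrangements peak_free {} (X :: 'a::linorder set)) = 2 ^ (card X - 1)"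
  using assms
proof (induction X rule: finite_linorder_max_induct)
  case (insert m X)
  let ?V = "arrangements peak_free {}"
  note V = arrangements_empty[OF hereditary_peak_free]
  show ?case
  proof (cases "X = {}")
    case True
    have "?V {m} = {[m]}" unfolding V by (auto simp: peak_free_def)
    thus ?thesis using True by simp
  next
    case False
    have mX: "m \<notin> X" using insert.hyps by blast
    have eq: "?V (insert m X) = (#) m ` ?V X \<union> (\<lambda>xs. xs @ [m]) ` ?V X" (is "?L = ?R")
    proof
      show "?L \<subseteq> ?R"
      proof
        fix xs assume "xs \<in> ?L"
        hence xs: "distinct xs" "set xs = insert m X" "peak_free xs"
          by (auto simp: V permutations_of_set_def)
        then obtain us vs where e: "xs = us @ m # vs" by (metis insertI1 split_list)
        have s: "set us \<union> set vs = X" "distinct (us @ vs)" using xs(1,2) mX unfolding e by auto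
        hence "us = [] \<or> vs = []" using peak_free_max_at_end[of us m vs] xs(3) e insert by simp
        thus "xs \<in> ?R"
        proof
          assume "us = []"
          hence "xs = m # vs" "vs \<in> ?V X"
            using s xs(3) e insert peak_free_Cons_max[of vs m] by (auto simp: V permutations_of_set_def)
          thus ?thesis by blast
        next
          assume "vs = []"
          hence "xs = us @ [m]" "us \<in> ?V X"
            using s xs(3) e insert peak_free_snoc_max[of us m] by (auto simp: V permutations_of_set_def)
          thus ?thesis by blast
        qed
      qed
      show "?R \<subseteq> ?L"
      proof -
        have "m # xs \<in> ?L" "xs @ [m] \<in> ?L" if "xs \<in> ?V X" for xs
          using that mX insert.hyps peak_free_Cons_max[of xs m] peak_free_snoc_max[of xs m]
          by (simp_all add: V permutations_of_set_def)
        thus ?thesis by blast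
      qed
    qed
    \<comment> \<open>This is where \<open>X \<noteq> {}\<close> enters: for empty \<open>X\<close> both ends give the word \<open>[m]\<close>.\<close>
    have "(#) m ` ?V X \<inter> (\<lambda>xs. xs @ [m]) ` ?V X = {}"
    proof -
      have "m # xs \<noteq> ys @ [m]" if "xs \<in> ?V X" "ys \<in> ?V X" for xs ys
        using that mX False by (cases ys) (auto simp: V permutations_of_set_def)
      thus ?thesis by blast
    qed
    hence "card (?V (insert m X)) = card ((#) m ` ?V X) + card ((\<lambda>xs. xs @ [m]) ` ?V X)"
      unfolding eq using insert.hyps(1) by (intro card_Un_disjoint) auto
    also have "\<dots> = card (?V X) + card (?V X)"
      by (intro arg_cong2[where f = "(+)"] card_image) (auto simp: inj_on_def)
    also have "\<dots> = 2 ^ card X"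
      using insert.IH False insert.hyps(1) by (cases "card X") auto
    finally show ?thesis using insert.hyps(1) mX by simp
  qed
qed simp

text \<open>
  Induction on the largest cut: each further cut costs the shape without interior peaks one factor
  2 relative to the increasing shape, since \<open>2 ^ (b - 1) = 2 * 2 ^ (b' - 1) * 2 ^ (b'' - 1)\<close>
  for positive \<open>b'\<close> and \<open>b''\<close> with sum \<open>b\<close>. The power \<open>2 ^ card T\<close> stands on the left to avoid
  the truncated exponent \<open>card X - 1 - card T\<close>.
\<close>
lemma card_peak_free_vs_increasing:
  assumes "finite T" "finite X" "T \<subseteq> {0<..<card (X :: 'a::linorder set)}" "X \<noteq> {}"
  shows "2 ^ card T * card (arrangements peak_free T X)
    = 2 ^ (card X - 1) * card (arrangements increasing T X)"
  using assms
proof (induction T arbitrary: X rule: finite_linorder_max_induct)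
  case empty
  thus ?case by (simp add: card_increasing_arrangements card_peak_free_arrangements)
next
  case (insert t A)
  let ?C = "{Y. Y \<subseteq> X \<and> card Y = t}"
  have t: "0 < t" "t < card X" using insert.prems by auto
  have A: "A \<subseteq> {..<t}" using insert.hyps by blast
  have split: "card (arrangements P (insert t A) X)
      = (\<Sum>Y\<in>?C. card (arrangements P A Y) * card (arrangements P {} (X - Y)))"
    if "hereditary P" for P
    using card_arrangements_insert[OF that insert.prems(1) A] t by simp
  have "2 ^ card (insert t A) * (card (arrangements peak_free A Y) * card (arrangements peak_free {} (X - Y)))
      = 2 ^ (card X - 1) * (card (arrangements increasing A Y) * card (arrangements increasing {} (X - Y)))"
    if Y: "Y \<in> ?C" for Y
  proof -
    have fin: "finite Y" using Y insert.prems finite_subset by auto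
    have cXY: "card (X - Y) = card X - t" using Y fin by (simp add: card_Diff_subset)
    have "X - Y \<noteq> {}" using cXY t by (metis card.empty zero_less_diff less_irrefl)
    hence 1: "card (arrangements peak_free {} (X - Y)) = 2 ^ (card X - t - 1)"
      using card_peak_free_arrangements[of "X - Y"] insert.prems(1) cXY by simp
    have 2: "card (arrangements increasing {} (X - Y)) = 1"
      using insert.prems by (intro card_increasing_arrangements) auto
    have "A \<subseteq> {0<..<card Y}" using A insert.prems(2) Y by fastforce
    moreover have "Y \<noteq> {}" using Y t by auto
    ultimately have 3: "2 ^ card A * card (arrangements peak_free A Y) = 2 ^ (t - 1) * card (arrangements increasing A Y)"
      using insert.IH[OF fin] Y by simp
    have 4: "2 ^ card (insert t A) = (2 * 2 ^ card A :: nat)"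
      using insert.hyps by (subst card_insert_disjoint) auto
    have "card X - 1 = Suc ((t - 1) + (card X - t - 1))" using t by simp
    hence 5: "2 ^ (card X - 1) = (2 * (2 ^ (t - 1) * 2 ^ (card X - t - 1)) :: nat)"
      by (simp only: power_Suc power_add)
    show ?thesis unfolding 1 2 4 5 using 3 by (simp add: ac_simps)
  qed
  thus ?case
    unfolding split[OF hereditary_peak_free] split[OF hereditary_increasing] sum_distrib_left
    by (intro sum.cong) auto
qed


section \<open>Descents and peaks of permutations\<close>

definition descent_set :: "nat \<Rightarrow> (nat \<Rightarrow> nat) \<Rightarrow> nat set"
  where "descent_set n \<pi> = {i \<in> {1..n}. \<pi> (i + 1) < \<pi> i}"

definition word :: "nat \<Rightarrow> (nat \<Rightarrow> nat) \<Rightarrow> nat list"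
  where "word n \<pi> = map \<pi> [1..<n + 2]"

lemma length_word [simp]: "length (word n \<pi>) = n + 1"
  by (simp add: word_def)

lemma nth_word: "i \<le> n \<Longrightarrow> word n \<pi> ! i = \<pi> (i + 1)"
  by (simp add: word_def nth_append del: upt_Suc)

lemma bij_betw_word:
  "bij_betw (word n) {\<pi>. \<pi> permutes {1..n + 1}} (permutations_of_set {1..n + 1})"
proof -
  let ?P = "{\<pi>. \<pi> permutes {1..n + 1}}"
  have inj: "inj_on (word n) ?P"
  proof (rule inj_onI)
    fix \<pi> \<sigma> assume p: "\<pi> \<in> ?P" "\<sigma> \<in> ?P" and eq: "word n \<pi> = word n \<sigma>"
    show "\<pi> = \<sigma>"
    proof
      fix i show "\<pi> i = \<sigma> i"
      proof (cases "i \<in> {1..n + 1}")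
        case True
        hence "i - 1 \<le> n" "i - 1 + 1 = i" by auto
        thus ?thesis using nth_word[of "i - 1" n] eq by metis
      next
        case False
        thus ?thesis using p by (simp add: permutes_not_in)
      qed
    qed
  qed
  have sub: "word n ` ?P \<subseteq> permutations_of_set {1..n + 1}"
  proof (intro image_subsetI)
    fix \<pi> assume "\<pi> \<in> ?P"
    hence p: "\<pi> permutes {1..n + 1}" by simp
    have s: "set [1..<n + 2] = {1..n + 1}" by (simp only: set_upt) auto
    have "distinct (word n \<pi>)"
      unfolding word_def distinct_map by (intro conjI distinct_upt permutes_inj_on[OF p])
    moreover have "set (word n \<pi>) = {1..n + 1}"
      unfolding word_def set_map s using permutes_image[OF p] .
    ultimately show "word n \<pi> \<in> permutations_of_set {1..n + 1}"
      by (simp add: permutations_of_set_def)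
  qed
  \<comment> \<open>Surjectivity comes from counting, as both sides have \<open>(n + 1)!\<close> elements.\<close>
  have "card (word n ` ?P) = card (permutations_of_set {1..n + 1})"
    unfolding card_image[OF inj] using card_permutations[of "{1..n + 1}" "n + 1"] by simp
  hence "word n ` ?P = permutations_of_set {1..n + 1}"
    using sub by (intro card_subset_eq) auto
  thus ?thesis using inj by (simp add: bij_betw_def)
qed

text \<open>
  A descent at \<open>i\<close> is seen in a factor of length 2, which only a cut after \<open>i\<close> can divide; a peak
  at \<open>i\<close> is seen in a factor of length 3, which cuts after \<open>i - 1\<close> and after \<open>i\<close> can divide. The
  latter is why the peak condition involves \<open>Suc ` T\<close> besides \<open>T\<close>.
\<close>
lemma descent_set_subset_iff:
  assumes "\<pi> permutes {1..n + 1}"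
  shows "descent_set n \<pi> \<subseteq> T \<longleftrightarrow> blockwise increasing T (word n \<pi>)"
proof
  assume D: "descent_set n \<pi> \<subseteq> T"
  show "blockwise increasing T (word n \<pi>)"
    unfolding blockwise_def
  proof (intro allI impI)
    fix a b assume ab: "a \<le> b" "b \<le> length (word n \<pi>)" "T \<inter> {a<..<b} = {}"
    show "increasing (drop a (take b (word n \<pi>)))"
      unfolding sorted_wrt_iff_nth_Suc_transp[OF transp_on_less]
    proof (intro allI impI)
      fix i assume "Suc i < length (drop a (take b (word n \<pi>)))"
      hence i: "a + i + 1 < b" using ab by simp
      let ?j = "a + i + 1"
      have "?j \<notin> T" using ab(3) i by auto
      hence "?j \<notin> descent_set n \<pi>" using D by blast
      moreover have jn: "1 \<le> ?j" "?j \<le> n" using i ab(2) by auto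
      ultimately have "\<pi> ?j \<le> \<pi> (?j + 1)" by (auto simp: descent_set_def)
      moreover have "\<pi> ?j \<noteq> \<pi> (?j + 1)"
        using permutes_inj[OF assms] by (metis injD less_add_one less_irrefl)
      ultimately show "drop a (take b (word n \<pi>)) ! i < drop a (take b (word n \<pi>)) ! Suc i"
        using i ab jn by (simp add: nth_word)
    qed
  qed
next
  assume b: "blockwise increasing T (word n \<pi>)"
  show "descent_set n \<pi> \<subseteq> T"
  proof (rule ccontr)
    assume "\<not> descent_set n \<pi> \<subseteq> T"
    then obtain i where i: "1 \<le> i" "i \<le> n" "\<pi> (i + 1) < \<pi> i" "i \<notin> T"
      by (auto simp: descent_set_def)
    have "{i - 1<..<i + 1} = {i}" using i by auto
    hence "increasing (drop (i - 1) (take (i + 1) (word n \<pi>)))"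
      using b[unfolded blockwise_def, rule_format, of "i - 1" "i + 1"] i by simp
    from sorted_wrt_nth_less[OF this, of 0 1] show False
      using i by (simp add: nth_word)
  qed
qed

lemma peak_set_subset_iff:
  "peak_set n \<pi> \<subseteq> T \<union> Suc ` T \<longleftrightarrow> blockwise peak_free T (word n \<pi>)"
proof
  assume D: "peak_set n \<pi> \<subseteq> T \<union> Suc ` T"
  show "blockwise peak_free T (word n \<pi>)"
    unfolding blockwise_def
  proof (intro allI impI)
    fix a b assume ab: "a \<le> b" "b \<le> length (word n \<pi>)" "T \<inter> {a<..<b} = {}"
    let ?w = "drop a (take b (word n \<pi>))"
    show "peak_free ?w"
      unfolding peak_free_def
    proof (intro allI impI)
      fix i assume "i + 2 < length ?w"
      hence i: "a + i + 2 < b" using ab by simp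
      have "a + i + 2 \<notin> T" "a + i + 1 \<notin> T" using ab(3) i by auto
      hence "a + i + 2 \<notin> peak_set n \<pi>" using D by auto
      moreover have "?w ! i = \<pi> (a + i + 1)" "?w ! (i + 1) = \<pi> (a + i + 2)" "?w ! (i + 2) = \<pi> (a + i + 3)"
        using i ab by (simp_all add: nth_word numeral_3_eq_3)
      ultimately show "\<not> (?w ! i < ?w ! (i + 1) \<and> ?w ! (i + 2) < ?w ! (i + 1))"
        using i ab by (auto simp: peak_set_def numeral_3_eq_3)
    qed
  qed
next
  assume b: "blockwise peak_free T (word n \<pi>)"
  show "peak_set n \<pi> \<subseteq> T \<union> Suc ` T"
  proof (rule ccontr)
    assume "\<not> peak_set n \<pi> \<subseteq> T \<union> Suc ` T"
    then obtain i where i: "i \<in> peak_set n \<pi>" "i \<notin> T" "i \<notin> Suc ` T" by blast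
    then obtain j where j: "i = j + 2" by (metis (lifting) add.commute le_iff_add mem_Collect_eq peak_set_def)
    have n: "j + 2 \<le> n" and p: "\<pi> (j + 1) < \<pi> (j + 2)" "\<pi> (j + 3) < \<pi> (j + 2)"
      using i(1) by (auto simp: j peak_set_def numeral_3_eq_3)
    have "T \<inter> {j<..<j + 3} = {}"
    proof -
      have "{j<..<j + 3} = {j + 1, j + 2}" by auto
      thus ?thesis using i j by auto
    qed
    hence "peak_free (drop j (take (j + 3) (word n \<pi>)))"
      using b[unfolded blockwise_def, rule_format, of j "j + 3"] n by simp
    from this[unfolded peak_free_def, rule_format, of 0] show False
      using n p by (simp add: nth_word numeral_3_eq_3)
  qed
qed

lemma card_peak_vs_descent:
  assumes "T \<subseteq> {1..n}"
  shows "2 ^ (card T + 1) * card {\<pi>. \<pi> permutes {1..n + 1} \<and> peak_set n \<pi> \<subseteq> T \<union> Suc ` T}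
    = 2 ^ (n + 1) * card {\<pi>. \<pi> permutes {1..n + 1} \<and> descent_set n \<pi> \<subseteq> T}"
proof -
  let ?X = "{1..n + 1}"
  have transfer: "card {\<pi>. \<pi> permutes ?X \<and> Q \<pi>} = card (arrangements P T ?X)"
    if "\<And>\<pi>. \<pi> permutes ?X \<Longrightarrow> Q \<pi> \<longleftrightarrow> blockwise P T (word n \<pi>)" for P Q
  proof -
    have "bij_betw (word n) {\<pi>. \<pi> permutes ?X \<and> Q \<pi>} (arrangements P T ?X)"
      using bij_betw_word[of n] that
      unfolding bij_betw_def arrangements_def inj_on_def by blast
    thus ?thesis by (rule bij_betw_same_card)
  qed
  have "finite T" "T \<subseteq> {0<..<card ?X}"
    using finite_subset[OF assms] assms by auto
  from card_peak_free_vs_increasing[OF this(1) _ this(2)]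
  have "2 ^ card T * card (arrangements peak_free T ?X) = 2 ^ n * card (arrangements increasing T ?X)"
    by simp
  moreover have "card {\<pi>. \<pi> permutes ?X \<and> peak_set n \<pi> \<subseteq> T \<union> Suc ` T}
      = card (arrangements peak_free T ?X)"
    by (rule transfer) (rule peak_set_subset_iff)
  moreover have "card {\<pi>. \<pi> permutes ?X \<and> descent_set n \<pi> \<subseteq> T}
      = card (arrangements increasing T ?X)"
    by (rule transfer) (rule descent_set_subset_iff)
  ultimately show ?thesis by (simp only: power_add power_one_right mult_ac)
qed

lemma Lam_descent_set:
  assumes "\<pi> permutes {1..n + 1}"
  shows "Lam (descent_set n \<pi>) = peak_set n \<pi>"
proof -
  have "i \<in> Lam (descent_set n \<pi>) \<longleftrightarrow> i \<in> peak_set n \<pi>" for i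
  proof (cases "2 \<le> i")
    case True
    hence "i - 1 \<noteq> i" by simp
    hence "\<pi> (i - 1) \<noteq> \<pi> i" using permutes_inj[OF assms] by (metis injD)
    moreover have "i - 1 + 1 = i" using True by simp
    ultimately show ?thesis using True
      by (auto simp: Lam_def descent_set_def peak_set_def)
  next
    case False
    thus ?thesis by (auto simp: Lam_def descent_set_def peak_set_def)
  qed
  thus ?thesis by blast
qed

lemma peak_set_left_sparse: "peak_set n \<pi> \<in> left_sparse_sets n"
  by (auto simp: left_sparse_sets_def left_sparse_def peak_set_def)


section \<open>The peak element as a multiple of a sum of fundamentals\<close>

definition descent_element :: "nat \<Rightarrow> qseries"
  where "descent_element n = (\<Sum>\<pi> | \<pi> permutes {1..n + 1}. F_qsym n (descent_set n \<pi>))"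

lemma finite_left_sparse_sets [simp]: "finite (left_sparse_sets n)"
  by (rule finite_subset[of _ "Pow {1..n}"]) (auto simp: left_sparse_sets_def)

lemma peak_element_eq_sum: "peak_element n = (\<Sum>\<pi> | \<pi> permutes {1..n + 1}. Theta n (peak_set n \<pi>))"
proof -
  let ?P = "{\<pi>. \<pi> permutes {1..n + 1}}"
  have const: "(\<Sum>x\<in>A. f) = of_nat (card A) *\<^sub>q f" for A :: "(nat \<Rightarrow> nat) set" and f
    by (rule ext) (simp add: sum_qseries_apply qscale_def)
  have "(\<Sum>\<pi>\<in>?P. Theta n (peak_set n \<pi>))
      = (\<Sum>S\<in>left_sparse_sets n. \<Sum>\<pi>\<in>{\<pi>\<in>?P. peak_set n \<pi> = S}. Theta n (peak_set n \<pi>))"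
    using peak_set_left_sparse
    by (intro sum.group[symmetric]) (auto intro: finite_permutations)
  also have "\<dots> = (\<Sum>S\<in>left_sparse_sets n. \<Sum>\<pi>\<in>{\<pi>\<in>?P. peak_set n \<pi> = S}. Theta n S)"
    by (intro sum.cong) auto
  finally show ?thesis by (simp only: peak_element_def peak_number_def const mem_Collect_eq)
qed

text \<open>
  The common form of the expansions of \<open>F_qsym\<close> and \<open>Theta\<close>: the coefficient of \<open>M_qsym n T\<close>
  is a weight \<open>c T\<close>, present or absent according to a relation \<open>R\<close>. Summing over \<open>P\<close> turns
  the coefficients into counts.
\<close>
lemma sum_M_expansion:
  assumes "finite P" and f: "\<And>\<pi>. \<pi> \<in> P \<Longrightarrow> f \<pi> = (\<Sum>T\<in>{T. T \<subseteq> {1..n} \<and> R \<pi> T}. c T *\<^sub>q M_qsym n T)"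
  shows "(\<Sum>\<pi>\<in>P. f \<pi>) = (\<Sum>T\<in>Pow {1..n}. (c T * of_nat (card {\<pi>\<in>P. R \<pi> T})) *\<^sub>q M_qsym n T)"
proof
  fix m
  have "(\<Sum>\<pi>\<in>P. f \<pi>) m = (\<Sum>\<pi>\<in>P. \<Sum>T\<in>Pow {1..n}. if R \<pi> T then c T * M_qsym n T m else 0)"
    unfolding sum_qseries_apply
  proof (rule sum.cong[OF refl])
    fix \<pi> assume "\<pi> \<in> P"
    have "f \<pi> m = (\<Sum>T\<in>{T\<in>Pow {1..n}. R \<pi> T}. c T * M_qsym n T m)"
      by (simp add: f[OF \<open>\<pi> \<in> P\<close>] sum_qseries_apply qscale_def)
    thus "f \<pi> m = (\<Sum>T\<in>Pow {1..n}. if R \<pi> T then c T * M_qsym n T m else 0)"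
      by (simp add: sum.inter_filter del: Pow_iff)
  qed
  also have "\<dots> = (\<Sum>T\<in>Pow {1..n}. \<Sum>\<pi>\<in>P. if R \<pi> T then c T * M_qsym n T m else 0)"
    by (rule sum.swap)
  also have "\<dots> = (\<Sum>T\<in>Pow {1..n}. (c T * of_nat (card {\<pi>\<in>P. R \<pi> T})) *\<^sub>q M_qsym n T) m"
    unfolding sum_qseries_apply qscale_def
    using assms(1) by (simp add: sum.inter_filter[symmetric] mult_ac)
  finally show "(\<Sum>\<pi>\<in>P. f \<pi>) m
    = (\<Sum>T\<in>Pow {1..n}. (c T * of_nat (card {\<pi>\<in>P. R \<pi> T})) *\<^sub>q M_qsym n T) m" .
qed

lemma peak_element_eq_descent_element: "peak_element n = 2 ^ (n + 1) *\<^sub>q descent_element n"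
proof -
  let ?P = "{\<pi>. \<pi> permutes {1..n + 1}}"
  let ?p = "\<lambda>T. card {\<pi>\<in>?P. peak_set n \<pi> \<subseteq> T \<union> Suc ` T}"
  let ?d = "\<lambda>T. card {\<pi>\<in>?P. descent_set n \<pi> \<subseteq> T}"
  have fin: "finite ?P" by (simp add: finite_permutations)
  have "peak_element n = (\<Sum>T\<in>Pow {1..n}. (2 ^ (card T + 1) * of_nat (?p T)) *\<^sub>q M_qsym n T)"
    unfolding peak_element_eq_sum by (rule sum_M_expansion[OF fin]) (simp add: Theta_def)
  also have "\<dots> = (\<Sum>T\<in>Pow {1..n}. (2 ^ (n + 1) * (1 * of_nat (?d T))) *\<^sub>q M_qsym n T)"
  proof (rule sum.cong[OF refl])
    fix T assume "T \<in> Pow {1..n}"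
    hence "2 ^ (card T + 1) * ?p T = 2 ^ (n + 1) * ?d T" using card_peak_vs_descent by simp
    hence "rat_of_nat (2 ^ (card T + 1) * ?p T) = of_nat (2 ^ (n + 1) * ?d T)" by (rule arg_cong)
    thus "(2 ^ (card T + 1) * of_nat (?p T)) *\<^sub>q M_qsym n T
        = (2 ^ (n + 1) * (1 * of_nat (?d T))) *\<^sub>q M_qsym n T" by simp
  qed
  also have "\<dots> = 2 ^ (n + 1) *\<^sub>q (\<Sum>T\<in>Pow {1..n}. (1 * of_nat (?d T)) *\<^sub>q M_qsym n T)"
    by (simp only: qv.scale_sum_right qv.scale_scale)
  also have "(\<Sum>T\<in>Pow {1..n}. (1 * of_nat (?d T)) *\<^sub>q M_qsym n T) = descent_element n"
    unfolding descent_element_def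
    by (rule sum_M_expansion[OF fin, symmetric]) (simp add: F_qsym_def conj_commute)
  finally show ?thesis .
qed

lemma F_in_QSym: "S \<subseteq> {1..n} \<Longrightarrow> F_qsym n S \<in> QSym (n + 1)"
  unfolding span_F[symmetric] by (intro qv.span_base imageI PowI)

lemma descent_set_subset: "descent_set n \<pi> \<subseteq> {1..n}"
  by (auto simp: descent_set_def)

lemma descent_element_in_QSym: "descent_element n \<in> QSym (n + 1)"
  unfolding descent_element_def
  by (intro qv.subspace_sum[OF subspace_QSym] F_in_QSym descent_set_subset)

lemma vartheta_sum:
  assumes "\<And>x. x \<in> A \<Longrightarrow> f x \<in> QSym (n + 1)"
  shows "vartheta n (\<Sum>x\<in>A. f x) = (\<Sum>x\<in>A. vartheta n (f x))"
proof -
  have 0: "vartheta n 0 = 0"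
    using vartheta_scale[OF qv.subspace_0[OF subspace_QSym], of n 0] by simp
  show ?thesis using assms
  proof (induction A rule: infinite_finite_induct)
    case (insert x A)
    hence "(\<Sum>x\<in>A. f x) \<in> QSym (n + 1)" by (intro qv.subspace_sum[OF subspace_QSym]) auto
    thus ?case using insert by (simp only: sum.insert vartheta_add insert_iff simp_thms)
  qed (simp_all add: 0)
qed

lemma vartheta_descent_element: "vartheta n (descent_element n) = peak_element n"
proof -
  have "vartheta n (descent_element n)
      = (\<Sum>\<pi> | \<pi> permutes {1..n + 1}. vartheta n (F_qsym n (descent_set n \<pi>)))"
    unfolding descent_element_def
    by (intro vartheta_sum F_in_QSym descent_set_subset)
  also have "\<dots> = (\<Sum>\<pi> | \<pi> permutes {1..n + 1}. Theta n (peak_set n \<pi>))"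
    by (intro sum.cong refl) (simp add: vartheta_F[OF descent_set_subset] Lam_descent_set)
  finally show ?thesis by (simp only: peak_element_eq_sum)
qed

lemma sum_in_peak_algebra:
  "(\<And>x. x \<in> A \<Longrightarrow> f x \<in> peak_algebra) \<Longrightarrow> (\<Sum>x\<in>A. f x) \<in> peak_algebra"
proof -
  \<comment> \<open>For the empty sum; closure under scaling by 0 puts 0 in the algebra.\<close>
  have "0 *\<^sub>q qone \<in> peak_algebra" by (intro peak_algebra.scale peak_algebra.one)
  hence "0 \<in> peak_algebra" by simp
  thus "(\<And>x. x \<in> A \<Longrightarrow> f x \<in> peak_algebra) \<Longrightarrow> (\<Sum>x\<in>A. f x) \<in> peak_algebra"
    by (induction A rule: infinite_finite_induct)
      (simp_all add: peak_algebra.add del: plus_fun_apply)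
qed

text \<open>
  Every \<open>F_qsym n S\<close> with \<open>S \<subseteq> {1..n}\<close> contains \<open>M_qsym n {1..n}\<close> with coefficient 1, so
  there is no cancellation at that place.
\<close>
lemma descent_element_nonzero: "descent_element n \<noteq> 0"
proof
  assume z: "descent_element n = 0"
  let ?P = "{\<pi>. \<pi> permutes {1..n + 1}}"
  let ?m = "mon [0..<length (comp_of n {1..n})] (comp_of n {1..n})"
  have "descent_element n ?m = (\<Sum>\<pi>\<in>?P. 1)"
    unfolding descent_element_def sum_qseries_apply
    by (intro sum.cong refl) (simp only: F_mon[OF subset_refl] descent_set_subset of_bool_eq)
  also have "\<dots> = of_nat (fact (n + 1))"
    using card_permutations[of "{1..n + 1}" "n + 1"] by simp
  finally have "rat_of_nat (fact (n + 1)) = 0" by (simp only: z zero_fun_apply)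
  thus False by (simp only: of_nat_eq_0_iff fact_nonzero)
qed

theorem proposition3p2:
  fixes n :: nat
  shows "peak_element n \<in> peak_component (n + 1)
    \<and> peak_element n \<noteq> 0
    \<and> Theta_nonneg n (peak_element n)
    \<and> vartheta n (peak_element n) = 2 ^ (n + 1) *\<^sub>q peak_element n"
proof (intro conjI)
  have "peak_element n \<in> peak_algebra"
    unfolding peak_element_def
    by (intro sum_in_peak_algebra peak_algebra.scale peak_algebra.generator)
  moreover have "peak_element n \<in> QSym (n + 1)"
    unfolding peak_element_eq_descent_element
    by (intro qv.subspace_scale[OF subspace_QSym] descent_element_in_QSym)
  ultimately show "peak_element n \<in> peak_component (n + 1)"
    by (simp add: peak_component_def)
  show "peak_element n \<noteq> 0"
    unfolding peak_element_eq_descent_element qv.scale_eq_0_iff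
    using descent_element_nonzero by simp
  show "Theta_nonneg n (peak_element n)"
    unfolding Theta_nonneg_def peak_element_def
    by (intro exI[of _ "\<lambda>S. of_nat (peak_number n S)"]) simp
  have "vartheta n (peak_element n) = vartheta n (2 ^ (n + 1) *\<^sub>q descent_element n)"
    by (simp only: peak_element_eq_descent_element)
  also have "\<dots> = 2 ^ (n + 1) *\<^sub>q peak_element n"
    by (simp only: vartheta_scale[OF descent_element_in_QSym] vartheta_descent_element)
  finally show "vartheta n (peak_element n) = 2 ^ (n + 1) *\<^sub>q peak_element n" .
qed

end
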